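(* Let $p\geq 1$, $A>0$, and let $0<a_1\leq\dots\leq a_p$ and $0<b_1\leq\dots\leq b_p$ satisfy $\sum_{j=1}^kb_j-\sum_{j=1}^ka_j\geq 0$ for $k=1,\dots,p$. Suppose in addition that $$\prod_{i=1}^{p}\left[\frac{\Gamma(a_i+A)}{\Gamma(b_i+A)}-\frac{\Gamma(a_i+2A)}{\Gamma(b_i+2A)}(1-e)\right]\leq\frac{2}{\sqrt5}\prod_{i=1}^{p}\frac{\Gamma(a_i)}{\Gamma(b_i)}.$$ Then the function $$z\mapsto{}_p\tilde{\Psi}_{p}\left[{(a_1,A),\dots,(a_p,A)\atop (b_1,A),\dots,(b_p,A)}\Big|z\right]$$ is starlike in $\mathcal{D}=\{z\in\mathbb{C}:|z|<1\}$.
   Context: The normalized Fox-Wright function is $${}_p\tilde{\Psi}_q\left[{(a_1,A_1),\dots,(a_p,A_p)\atop (b_1,B_1),\dots,(b_q,B_q)}\Big|z\right]=\frac{\prod_{j=1}^q\Gamma(b_j)}{\prod_{i=1}^p\Gamma(a_i)}\sum_{k=0}^\infty\frac{\prod_{i=1}^p\Gamma(a_i+kA_i)}{\prod_{j=1}^q\Gamma(b_j+kB_j)}\frac{z^{k+1}}{k!}.$$ A function $f(z)=z+\sum_{k\ge2}a_kz^k$ analytic in $\mathcal{D}$ is starlike in $\mathcal{D}$ if it is univalent and $f(\mathcal{D})$ is starlike with respect to the origin; equivalently $\Re\left(zf'(z)/f(z)\right)>0$ for all $z\in\mathcal{D}$. Here $e=\exp(1)$. *)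

theory Defs
  imports "HOL-Complex_Analysis.Complex_Analysis"
begin

text \<open>
  Parameter tuples are functions on the indices \<open>1, ..., p\<close> and \<open>1, ..., q\<close>; values outside
  these ranges are irrelevant. The power is \<open>z ^ (k + 1)\<close> since the normalization includes
  an extra factor \<open>z\<close>. As usual for \<open>suminf\<close>, the value is meaningful where the series converges.
\<close>

definition normalized_fox_wright ::
  "nat \<Rightarrow> nat \<Rightarrow> (nat \<Rightarrow> complex) \<Rightarrow> (nat \<Rightarrow> real) \<Rightarrow> (nat \<Rightarrow> complex) \<Rightarrow> (nat \<Rightarrow> real)
    \<Rightarrow> complex \<Rightarrow> complex"
where
  "normalized_fox_wright p q a A b B z =
     (\<Prod>j=1..q. Gamma (b j)) / (\<Prod>i=1..p. Gamma (a i)) *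
     (\<Sum>k. (\<Prod>i=1..p. Gamma (a i + of_nat k * of_real (A i))) /
           (\<Prod>j=1..q. Gamma (b j + of_nat k * of_real (B j))) * (z ^ (k + 1) / fact k))"

text \<open>
  The conditions \<open>f 0 = 0\<close> and \<open>deriv f 0 = 1\<close> express the expansion
  \<open>f z = z + a\<^sub>2 z\<^sup>2 + ...\<close>. The library predicate \<open>starlike\<close> is not used because
  it leaves the centre unspecified, whereas here the centre must be the origin.
\<close>

definition starlike_function :: "(complex \<Rightarrow> complex) \<Rightarrow> bool" where
  "starlike_function f \<longleftrightarrow>
     f holomorphic_on ball 0 1 \<and> f 0 = 0 \<and> deriv f 0 = 1 \<and>
     inj_on f (ball 0 1) \<and>
     (\<forall>w \<in> f ` ball 0 1. closed_segment 0 w \<subseteq> f ` ball 0 1)"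

end

(*
  Write c k for the quotient of the Gamma ratio at k A by its value at 0, so that the function
  is f z = z * g z with g z = sum c k z^k / k!. Weak majorization makes the sequence c decreasing
  with (c 1)^2 <= c 2, because -Digamma and Polygamma 1 are decreasing and convex. The product
  hypothesis gives c 1 + (e - 1) c 2 <= 2 / sqrt 5. Since c k <= c 2 for k >= 3, the tails of g and
  z g' are bounded by multiples of c 2, and comparing the quadratic parts on |z| = 1 gives |z g'| < |g|;
  smaller radii r follow by replacing c k with c k r^k, which satisfies the same conditions.
  Hence Re (z f' / f) > 0.

  For univalence and starlikeness, put g = exp h and pass to the logarithmic coordinate z = exp w:
  F w = w + h (exp w) has Re F' > 0 on the left half-plane, so, by Noshiro-Warschawski, moving F w
  to the left along a horizontal line strictly decreases Re w = ln |z|.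
*)

theory Submission
  imports Defs
begin

section \<open>Starlikeness from a positive real part\<close>

text \<open>The key fact is \<open>f_shift\<close>: if f z1 = t f z2 with 0 < t \<le> 1 and z1
  \<noteq> z2, then |z1| < |z2|. The case t = 1 gives univalence. The case t < 1 keeps preimages of
  points on a segment from 0 inside a compact disc, so the part of the segment covered by the image
  is clopen.\<close>

lemma starlike_function_mult:
  assumes g: "g holomorphic_on ball 0 1" and g0: "g 0 = 1"
    and gnz: "\<And>z. z \<in> ball 0 1 \<Longrightarrow> g z \<noteq> 0"
    and pos: "\<And>z. z \<in> ball 0 1 \<Longrightarrow> Re (1 + z * deriv g z / g z) > 0"
  shows "starlike_function (\<lambda>z. z * g z)"
proof -
  let ?D = "ball 0 1 :: complex set"
  define f where "f = (\<lambda>z. z * g z)"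
  obtain h where h: "h holomorphic_on ?D" and gh: "\<And>z. z \<in> ?D \<Longrightarrow> g z = exp (h z)"
    using contractible_imp_holomorphic_log[OF g convex_imp_contractible[OF convex_ball] gnz]
    by metis
  have dh: "(h has_field_derivative deriv h z) (at z)" if "z \<in> ?D" for z
    using holomorphic_derivI[OF h open_ball that] .
  have pos': "Re (1 + z * deriv h z) > 0" if z: "z \<in> ?D" for z
  proof -
    have "(g has_field_derivative exp (h z) * deriv h z) (at z)"
      by (rule has_field_derivative_transform_within_open[of "\<lambda>z. exp (h z)" _ _ ?D])
         (use z gh dh in \<open>auto intro!: derivative_eq_intros\<close>)
    then have "deriv g z = g z * deriv h z"
      using gh[OF z] by (simp add: DERIV_imp_deriv)
    then show ?thesis using pos[OF z] gnz[OF z] by simp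
  qed
  define F where "F = (\<lambda>w. w + h (exp w))"
  have dF: "(F has_field_derivative 1 + exp w * deriv h (exp w)) (at w)" if "Re w < 0" for w
  proof -
    have "((h \<circ> exp) has_field_derivative deriv h (exp w) * exp w) (at w)"
      by (rule DERIV_chain[OF dh]) (use that in \<open>auto intro: derivative_intros\<close>)
    then show ?thesis unfolding F_def o_def
      by (auto intro!: derivative_eq_intros simp: mult.commute)
  qed
  have F_shift: "Re w1 < Re w2"
    if w: "Re w1 < 0" "Re w2 < 0" "w1 \<noteq> w2" and s: "s \<ge> 0" "F w2 - F w1 = of_real s" for w1 w2 s
  proof -
    have seg: "Re u < 0" if "u \<in> closed_segment w1 w2" for u
      using closed_segment_subset[OF _ _ convex_halfspace_Re_lt[of 0], of w1 w2] w that by auto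
    \<comment> \<open>The complex mean value theorem concerns real parts only. Dividing by w2 - w1
      beforehand cancels the chord, so that Re F' itself appears at the intermediate point.\<close>
    have "((\<lambda>w. F w / (w2 - w1)) has_field_derivative (1 + exp u * deriv h (exp u)) / (w2 - w1)) (at u)"
      if "u \<in> closed_segment w1 w2" for u
      by (intro DERIV_cdivide dF seg that)
    from complex_mvt_line[OF this] obtain u where u: "u \<in> closed_segment w1 w2"
      and "Re (F w2 / (w2 - w1)) - Re (F w1 / (w2 - w1))
             = Re ((1 + exp u * deriv h (exp u)) / (w2 - w1) * (w2 - w1))"
      by blast
    then have "Re ((F w2 - F w1) / (w2 - w1)) = Re (1 + exp u * deriv h (exp u))"
      using w by (simp add: diff_divide_distrib)
    also have "\<dots> > 0"
      by (rule pos') (use seg[OF u] in simp)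
    finally have "s * Re (w2 - w1) > 0"
      unfolding s Re_complex_div_gt_0 by simp
    then show ?thesis using s(1) by (simp add: zero_less_mult_iff)
  qed
  have f_eq_0: "f z = 0 \<longleftrightarrow> z = 0" if "z \<in> ?D" for z
    using gnz[OF that] by (simp add: f_def)
  have f_shift: "norm z1 < norm z2"
    if z: "z1 \<in> ?D" "z2 \<in> ?D" "z1 \<noteq> z2" "z2 \<noteq> 0"
      and t: "0 < t" "t \<le> 1" "f z1 = of_real t * f z2" for z1 z2 t
  proof -
    have z1: "z1 \<noteq> 0" using z t f_eq_0[of z2] by (auto simp: f_def)
    have "exp (Ln z1 + h z1) = exp (of_real (ln t) + Ln z2 + h z2)"
      using z z1 t gh by (simp add: exp_add f_def exp_of_real)
    then obtain n :: int
      where n: "Ln z1 + h z1 = of_real (ln t) + Ln z2 + h z2 + of_real (of_int (2 * n) * pi) * \<i>"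
      unfolding exp_eq by blast
    \<comment> \<open>The multiple of 2 pi i is absorbed into the choice of logarithm of z1. This
      makes F (Ln z2) - F w1 exactly the real number -ln t.\<close>
    define w1 where "w1 = Ln z1 - of_real (of_int (2 * n) * pi) * \<i>"
    have "exp w1 = exp (Ln z1)"
      unfolding exp_eq by (rule exI[of _ "-n"]) (simp add: w1_def)
    then have w1: "exp w1 = z1" using z1 by simp
    have w2: "exp (Ln z2) = z2" using z by simp
    have "Re w1 < Re (Ln z2)"
    proof (rule F_shift)
      have "exp (Re w1) < 1" "exp (Re (Ln z2)) < 1"
        unfolding norm_exp_eq_Re[symmetric] w1 w2 using z by auto
      then show "Re w1 < 0" "Re (Ln z2) < 0" by auto
      show "w1 \<noteq> Ln z2" using w1 w2 z by auto
      show "- ln t \<ge> 0" using t by simp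
      show "F (Ln z2) - F w1 = of_real (- ln t)"
        unfolding F_def w1 w2 using n by (simp add: w1_def algebra_simps)
    qed
    then have "exp (Re w1) < exp (Re (Ln z2))" by simp
    then show ?thesis unfolding norm_exp_eq_Re[symmetric] w1 w2 .
  qed
  have holf: "f holomorphic_on ?D" unfolding f_def by (intro holomorphic_intros g)
  have inj: "inj_on f ?D"
  proof (rule inj_onI, rule ccontr)
    fix z1 z2 assume z: "z1 \<in> ?D" "z2 \<in> ?D" "f z1 = f z2" "z1 \<noteq> z2"
    then have "z1 \<noteq> 0" "z2 \<noteq> 0" using f_eq_0 by metis+
    \<comment> \<open>For t = 1 the relation is symmetric, so each modulus would be strictly smaller
      than the other.\<close>
    then show False
      using f_shift[of z1 z2 1] f_shift[of z2 z1 1] z by simp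
  qed
  have "(f has_field_derivative 1) (at 0)"
    unfolding f_def using holomorphic_derivI[OF g open_ball, of 0]
    by (auto intro!: derivative_eq_intros simp: g0)
  then have df: "deriv f 0 = 1" by (rule DERIV_imp_deriv)
  have seg: "closed_segment 0 (f z0) \<subseteq> f ` ?D" if z0: "z0 \<in> ?D" "z0 \<noteq> 0" for z0
  proof -
    let ?S = "closed_segment 0 (f z0)"
    have sub: "cball 0 (norm z0) \<subseteq> ?D" using z0 by auto
    \<comment> \<open>The left side is relatively open by the open mapping theorem, the right side
      closed by compactness.\<close>
    have eq: "?S \<inter> f ` ?D = ?S \<inter> f ` cball 0 (norm z0)"
    proof (intro equalityI subsetI IntI)
      fix v assume v: "v \<in> ?S \<inter> f ` ?D"
      then obtain z where z: "z \<in> ?D" "v = f z" by blast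
      obtain t where t: "0 \<le> t" "t \<le> 1" "v = of_real t * f z0"
        using v by (auto simp: in_segment scaleR_conv_of_real)
      show "v \<in> f ` cball 0 (norm z0)"
      proof (cases "t = 0 \<or> z = z0")
        case True
        then have "z = 0 \<or> z = z0" using t z f_eq_0 by auto
        then show ?thesis using z by auto
      next
        case False
        then have "norm z < norm z0" using f_shift[of z z0 t] z z0 t by auto
        then show ?thesis using z by auto
      qed
    qed (use sub in auto)
    have "open (f ` ?D)"
      by (rule open_mapping_thm3[OF holf open_ball inj])
    then have 1: "openin (top_of_set ?S) (?S \<inter> f ` ?D)"
      by (rule openin_open_Int)
    have "compact (f ` cball 0 (norm z0))"
      by (rule compact_continuous_image[OF _ compact_cball])
         (use holomorphic_on_imp_continuous_on[OF holf] sub continuous_on_subset in blast)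
    then have 2: "closedin (top_of_set ?S) (?S \<inter> f ` ?D)"
      unfolding eq by (intro closedin_closed_Int compact_imp_closed)
    have "f z0 \<in> ?S \<inter> f ` ?D" using z0 by auto
    then have "?S \<inter> f ` ?D = ?S"
      using 1 2 connected_segment(1)[of 0 "f z0"] unfolding connected_clopen by blast
    then show ?thesis by blast
  qed
  have "closed_segment 0 v \<subseteq> f ` ?D" if v: "v \<in> f ` ?D" for v
  proof -
    obtain z where "z \<in> ?D" "v = f z" using v by blast
    then show ?thesis using seg[of z] by (cases "z = 0") (auto simp: f_def intro!: image_eqI[of _ _ 0])
  qed
  with holf inj df show ?thesis
    unfolding starlike_function_def f_def[symmetric] by (simp add: f_def)
qed

section \<open>Weak majorization and ratios of Gamma functions\<close>

text \<open>Abel summation in inductive form. The stronger bound w p * (d 1 + ... + d p) is carried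
  along: passing from w (p + 1) to the larger w p only increases its product with a nonnegative
  partial sum.\<close>

lemma sum_mult_antimono_nonneg:
  fixes w d :: "nat \<Rightarrow> real"
  assumes "\<And>i j. \<lbrakk>1 \<le> i; i \<le> j; j \<le> p\<rbrakk> \<Longrightarrow> w j \<le> w i"
    and "\<And>i. i \<in> {1..p} \<Longrightarrow> 0 \<le> w i"
    and "\<And>k. k \<in> {1..p} \<Longrightarrow> 0 \<le> (\<Sum>j=1..k. d j)"
  shows "0 \<le> (\<Sum>j=1..p. w j * d j)"
proof -
  have "w p * (\<Sum>j=1..p. d j) \<le> (\<Sum>j=1..p. w j * d j)"
    using assms(1,3)
  proof (induction p)
    case (Suc p)
    have "w (Suc p) * (\<Sum>j=1..p. d j) \<le> w p * (\<Sum>j=1..p. d j)"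
    \<comment> \<open>Monotonicity of w starts at index 1, so w 0 is not controlled; there the
      partial sum is empty.\<close>
    proof (cases "p = 0")
      case False
      then show ?thesis using Suc.prems(1)[of p "Suc p"] Suc.prems(2)[of p]
        by (intro mult_right_mono) auto
    qed auto
    moreover have "w p * (\<Sum>j=1..p. d j) \<le> (\<Sum>j=1..p. w j * d j)"
      using Suc.prems by (intro Suc.IH) auto
    ultimately show ?case by (simp add: algebra_simps)
  qed auto
  moreover have "0 \<le> w p * (\<Sum>j=1..p. d j)"
    using assms(2,3)[of p] by (cases "p = 0") auto
  ultimately show ?thesis by linarith
qed

text \<open>A form of the Tomic-Weyl inequality. The tangent of \<open>\<phi>\<close> at b i bounds
  each difference from below by -\<open>\<phi>'\<close> (b i) times b i - a i. These weights are
  nonnegative and decrease in i, since b and \<open>\<phi>'\<close> increase, so Abel summation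
  applies.\<close>

lemma sum_convex_antimono_majorization:
  fixes a b :: "nat \<Rightarrow> real" and \<phi> :: "real \<Rightarrow> real"
  assumes "\<And>x. x > 0 \<Longrightarrow> (\<phi> has_real_derivative \<phi>' x) (at x)"
    and "\<And>x. x > 0 \<Longrightarrow> (\<phi>' has_real_derivative \<phi>'' x) (at x)"
    and "\<And>x. x > 0 \<Longrightarrow> \<phi>' x \<le> 0" and "\<And>x. x > 0 \<Longrightarrow> \<phi>'' x \<ge> 0"
    and a: "\<And>i. i \<in> {1..p} \<Longrightarrow> a i > 0" and b: "\<And>i. i \<in> {1..p} \<Longrightarrow> b i > 0"
    and mono: "mono_on {1..p} b"
    and maj: "\<And>k. k \<in> {1..p} \<Longrightarrow> (\<Sum>j=1..k. a j) \<le> (\<Sum>j=1..k. b j)"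
  shows "(\<Sum>i=1..p. \<phi> (b i)) \<le> (\<Sum>i=1..p. \<phi> (a i))"
proof -
  have conv: "convex_on {0<..} \<phi>"
    by (rule f''_ge0_imp_convex[of _ _ \<phi>' \<phi>'']) (use assms(1,2,4) in auto)
  have tangent: "(- \<phi>' (b i)) * (b i - a i) \<le> \<phi> (a i) - \<phi> (b i)" if "i \<in> {1..p}" for i
    using convex_on_imp_above_tangent[OF conv _ _ _
        has_field_derivative_at_within[OF assms(1)], of "b i" "a i"] a[OF that] b[OF that]
    by (simp add: interior_open algebra_simps)
  have mono': "\<phi>' x \<le> \<phi>' y" if "0 < x" "x \<le> y" for x y
    by (rule DERIV_nonneg_imp_nondecreasing[OF that(2)])
       (use that(1) assms(2,4) less_le_trans in blast)
  have "0 \<le> (\<Sum>i=1..p. (- \<phi>' (b i)) * (b i - a i))"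
  proof (rule sum_mult_antimono_nonneg)
    show "- \<phi>' (b j) \<le> - \<phi>' (b i)" if "1 \<le> i" "i \<le> j" "j \<le> p" for i j
      using mono'[of "b i" "b j"] b[of i] mono_onD[OF mono, of i j] that by auto
    show "0 \<le> - \<phi>' (b i)" if "i \<in> {1..p}" for i
      using assms(3) b[OF that] by auto
    show "0 \<le> (\<Sum>j=1..k. b j - a j)" if "k \<in> {1..p}" for k
      using maj[OF that] by (simp add: sum_subtractf)
  qed
  also have "\<dots> \<le> (\<Sum>i=1..p. \<phi> (a i) - \<phi> (b i))"
    by (intro sum_mono tangent)
  finally show ?thesis by (simp add: sum_subtractf)
qed

text \<open>With L = ln R, the majorization inequality for -Digamma gives L' \<le> 0 and for the
  trigamma function L'' \<ge> 0. Hence R decreases and is log-convex; the second claim is convexity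
  of L at the midpoint h of 0 and 2 h.\<close>

lemma Gamma_ratio_majorization:
  fixes a b :: "nat \<Rightarrow> real" and p :: nat
  defines "R \<equiv> \<lambda>x. \<Prod>i=1..p. Gamma (a i + x) / Gamma (b i + x)"
  assumes a: "\<And>i. i \<in> {1..p} \<Longrightarrow> a i > 0" and b: "\<And>i. i \<in> {1..p} \<Longrightarrow> b i > 0"
    and mono: "mono_on {1..p} b"
    and maj: "\<And>k. k \<in> {1..p} \<Longrightarrow> (\<Sum>j=1..k. a j) \<le> (\<Sum>j=1..k. b j)"
  shows "\<And>x y. 0 \<le> x \<Longrightarrow> x \<le> y \<Longrightarrow> R y \<le> R x"
    and "\<And>h. 0 \<le> h \<Longrightarrow> (R h)\<^sup>2 \<le> R 0 * R (2 * h)"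
proof -
  define L L' L'' where
    "L = (\<lambda>x. \<Sum>i=1..p. ln_Gamma (a i + x) - ln_Gamma (b i + x))" and
    "L' = (\<lambda>x. \<Sum>i=1..p. Digamma (a i + x) - Digamma (b i + x))" and
    "L'' = (\<lambda>x. \<Sum>i=1..p. Polygamma 1 (a i + x) - Polygamma 1 (b i + x))"
  have R: "R x = exp (L x)" if "x \<ge> 0" for x
    unfolding R_def L_def exp_sum[OF finite_atLeastAtMost]
  proof (rule prod.cong)
    fix i assume i: "i \<in> {1..p}"
    show "Gamma (a i + x) / Gamma (b i + x) = exp (ln_Gamma (a i + x) - ln_Gamma (b i + x))"
      using a[OF i] b[OF i] that by (simp add: exp_diff Gamma_real_pos_exp)
  qed auto
  have nonpos: "x \<notin> \<int>\<^sub>\<le>\<^sub>0" if "x > 0" for x :: real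
    using that by (auto elim!: nonpos_Ints_cases)
  have dL: "(L has_real_derivative L' x) (at x)"
    and dL': "(L' has_real_derivative L'' x) (at x)" if x: "x \<ge> 0" for x
  proof -
    have "(ln_Gamma has_real_derivative Digamma (a i + x)) (at (a i + x))"
      "(ln_Gamma has_real_derivative Digamma (b i + x)) (at (b i + x))"
      "(Digamma has_real_derivative Polygamma 1 (a i + x)) (at (a i + x))"
      "(Digamma has_real_derivative Polygamma 1 (b i + x)) (at (b i + x))" if "i \<in> {1..p}" for i
      using has_field_derivative_Polygamma[of "a i + x" 0] has_field_derivative_Polygamma[of "b i + x" 0]
        has_field_derivative_ln_Gamma_real a[OF that] b[OF that] x nonpos
      by (simp_all add: add_pos_nonneg)
    then show "(L has_real_derivative L' x) (at x)" "(L' has_real_derivative L'' x) (at x)"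
      unfolding L_def L'_def L''_def
      by (intro DERIV_sum DERIV_diff; simp add: DERIV_shift add.commute)+
  qed
  \<comment> \<open>Adding x to every a i and b i adds k x to both k-th partial sums, so the
    majorization persists for every x \<ge> 0.\<close>
  have transl: "(\<Sum>i=1..p. \<phi> (b i + x)) \<le> (\<Sum>i=1..p. \<phi> (a i + x))"
    if "x \<ge> 0" and "\<And>x. x > 0 \<Longrightarrow> (\<phi> has_real_derivative \<phi>' x) (at x)"
    and "\<And>x. x > 0 \<Longrightarrow> (\<phi>' has_real_derivative \<phi>'' x) (at x)"
    and "\<And>x. x > 0 \<Longrightarrow> \<phi>' x \<le> 0" and "\<And>x. x > 0 \<Longrightarrow> \<phi>'' x \<ge> 0" for x \<phi> \<phi>' \<phi>''
    by (rule sum_convex_antimono_majorization[of \<phi> \<phi>' \<phi>''])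
       (use that a b mono maj in \<open>auto simp: add_pos_nonneg sum.distrib monotone_on_def\<close>)
  \<comment> \<open>On the positive axis polygamma functions of odd order are positive and those of
    positive even order negative. This supplies the signs of both derivatives, here and for
    \<open>L''_ge\<close>.\<close>
  have L'_le: "L' x \<le> 0" if "x \<ge> 0" for x
  proof -
    have "(\<Sum>i=1..p. - Digamma (b i + x)) \<le> (\<Sum>i=1..p. - Digamma (a i + x))"
      by (rule transl[of _ _ "\<lambda>x. - Polygamma 1 x" "\<lambda>x. - Polygamma 2 x"])
         (use that nonpos Polygamma_real_odd_pos[of _ 1] Polygamma_real_even_neg[of _ 2] in
          \<open>auto intro!: derivative_eq_intros less_imp_le simp: numeral_2_eq_2\<close>)
    then show ?thesis by (simp add: L'_def sum_subtractf sum_negf)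
  qed
  have L''_ge: "L'' x \<ge> 0" if "x \<ge> 0" for x
  proof -
    have Polygamma3: "Polygamma 3 x > 0" if "x > 0" for x :: real
      using that nonpos by (intro Polygamma_real_odd_pos) auto
    have "(\<Sum>i=1..p. Polygamma 1 (b i + x)) \<le> (\<Sum>i=1..p. Polygamma 1 (a i + x))"
      by (rule transl[of _ _ "Polygamma 2" "Polygamma 3"])
         (use that nonpos Polygamma3 Polygamma_real_even_neg[of _ 2] in
          \<open>auto intro!: derivative_eq_intros less_imp_le simp: numeral_2_eq_2 numeral_3_eq_3\<close>)
    then show ?thesis by (simp add: L''_def sum_subtractf)
  qed
  show "R y \<le> R x" if xy: "0 \<le> x" "x \<le> y" for x y
  proof -
    have "L y \<le> L x"
      by (rule DERIV_nonpos_imp_nonincreasing[OF xy(2)])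
         (use xy dL L'_le order_trans in blast)
    then show ?thesis using xy R by simp
  qed
  show "(R h)\<^sup>2 \<le> R 0 * R (2 * h)" if "0 \<le> h" for h
  proof -
    have "convex_on {0..} L"
      by (rule f''_ge0_imp_convex[of _ _ L' L'']) (use dL dL' L''_ge in auto)
    from convex_onD[OF this, of "1/2" 0 "2 * h"] have "2 * L h \<le> L 0 + L (2 * h)"
      using that by simp
    then show ?thesis using that R
      by (simp flip: exp_add exp_double add: power2_eq_square)
  qed
qed

section \<open>A product inequality and tails of exponential type\<close>

text \<open>In the expanded product all terms are nonnegative; only the pure x and pure y terms are
  kept. The latter carries the factor t^|I| \<ge> t, as t \<ge> 1 and I is nonempty. With t = e - 1
  this turns the product hypothesis into a bound on c 1 + (e - 1) c 2.\<close>

lemma prod_add_mult_ge: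
  fixes x y :: "'a \<Rightarrow> real"
  assumes "finite I" "I \<noteq> {}" "1 \<le> t" "\<And>i. i \<in> I \<Longrightarrow> 0 \<le> x i" "\<And>i. i \<in> I \<Longrightarrow> 0 \<le> y i"
  shows "(\<Prod>i\<in>I. x i) + t * (\<Prod>i\<in>I. y i) \<le> (\<Prod>i\<in>I. x i + t * y i)"
  using assms
proof (induction I rule: finite_ne_induct)
  case (insert i I)
  let ?X = "\<Prod>i\<in>I. x i" and ?Y = "\<Prod>i\<in>I. y i"
  have nn: "0 \<le> ?X" "0 \<le> ?Y" "0 \<le> x i" "0 \<le> y i" using insert by (auto intro: prod_nonneg)
  have "1 * (t * (y i * ?Y)) \<le> t * (t * (y i * ?Y))"
    using insert.prems nn by (intro mult_right_mono) auto
  moreover have "0 \<le> x i * (t * ?Y)" "0 \<le> t * y i * ?X"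
    using insert.prems nn by auto
  ultimately have "x i * ?X + t * (y i * ?Y) \<le> (x i + t * y i) * (?X + t * ?Y)"
    by (simp add: algebra_simps)
  also have "\<dots> \<le> (x i + t * y i) * (\<Prod>i\<in>I. x i + t * y i)"
    using insert nn by (intro mult_left_mono insert.IH) auto
  finally show ?case using insert by simp
qed simp

text \<open>The tail from m on is compared with the tail of the series of e from j on. The offsets
  are separate because the series of z g' has k / k! = 1 / (k - 1)!, which shifts the factorial by
  one.\<close>

lemma norm_suminf_diff_le_exp:
  fixes f :: "nat \<Rightarrow> 'a::banach"
  assumes "\<And>k. norm (f (k + m)) \<le> B / fact (k + j)"
  shows "norm (suminf f - (\<Sum>k<m. f k)) \<le> B * (exp 1 - (\<Sum>k<j. 1 / fact k))"
proof -
  have "(\<lambda>n. 1 / fact n) sums exp (1::real)"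
    using exp_converges[of "1::real"] by (simp add: field_simps)
  then have s: "(\<lambda>k. B * (1 / fact (k + j))) sums (B * (exp 1 - (\<Sum>k<j. 1 / fact k)))"
    by (intro sums_mult sums_split_initial_segment)
  have bd: "norm (f (k + m)) \<le> B * (1 / fact (k + j))" for k using assms by simp
  have "summable (\<lambda>k. f (k + m))"
    by (rule summable_comparison_test'[OF sums_summable[OF s], of 0]) (use bd in auto)
  then have "summable f" by (simp add: summable_iff_shift)
  then have "suminf f - (\<Sum>k<m. f k) = (\<Sum>k. f (k + m))"
    by (simp add: suminf_split_initial_segment[of f m])
  then show "norm (suminf f - (\<Sum>k<m. f k)) \<le> B * (exp 1 - (\<Sum>k<j. 1 / fact k))"
    using norm_suminf_le[OF bd sums_summable[OF s]] sums_unique[OF s] by simp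
qed

section \<open>Comparison of g and z g' on the unit circle\<close>

text \<open>
  The constants are roundings: \<open>1.718 \<le> e - 1\<close>, \<open>0.8945 \<ge> 2 / sqrt 5\<close>, and \<open>0.94 \<ge> 2 e - 9/2\<close>, the
  sum of the tail bounds \<open>e - 5/2\<close> and \<open>e - 2\<close>; further, \<open>2.35 = 0.94 / s\<close> and \<open>0.376 = 0.94 s\<close> with
  the AM--GM weight \<open>s = 2/5\<close> used below.
\<close>

lemma quadratic_part_poly:
  fixes u t x :: real
  assumes "0 \<le> u" "0 < t" "u\<^sup>2 \<le> t" "u + 1.718 * t \<le> 0.8945" "t \<le> u"
  shows "0 < 1 + u\<^sup>2 + t\<^sup>2/4 + 2*u*x + t*(2*x\<^sup>2 - 1) + u*t*x
           - (1 + 2.35 * t) * (u\<^sup>2 + t\<^sup>2 + 2*u*t*x) - 0.376 * t - (0.94 * t)\<^sup>2"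
proof -
  \<comment> \<open>As a quadratic in x the expression is 2 t x^2 + 2 u k x + C. Completing the
    square reduces positivity for all real x to u^2 k^2 < 2 t C.\<close>
  define k where "k = 1 - t/2 - 2.35 * t\<^sup>2"
  define C where "C = 1 - 1.376 * t - 1.6336 * t\<^sup>2 - 2.35 * t * u\<^sup>2 - 2.35 * t^3"
  let ?G = "1 + u\<^sup>2 + t\<^sup>2/4 + 2*u*x + t*(2*x\<^sup>2 - 1) + u*t*x
           - (1 + 2.35 * t) * (u\<^sup>2 + t\<^sup>2 + 2*u*t*x) - 0.376 * t - (0.94 * t)\<^sup>2"
  have sq: "2 * t * ?G = (2 * t * x + u * k)\<^sup>2 + (2 * t * C - u\<^sup>2 * k\<^sup>2)"
    by (simp add: k_def C_def power2_eq_square power3_eq_cube field_simps)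
  have disc: "u\<^sup>2 * k\<^sup>2 < 2 * t * C"
  \<comment> \<open>For small t, replacing u^2 by its bound t and cancelling t leaves a polynomial
    inequality in t alone. For larger t the linear constraint bounds u more sharply than u^2 \<le>
    t.\<close>
  proof (cases "t \<le> 0.28")
    case True
    have "t^2 \<le> 0.28^2" "t^3 \<le> 0.28^3" "t^4 \<le> 0.28^4"
      using True assms(2) by (intro power_mono; simp)+
    then have "1.752 * t + 3.5172 * t^2 + 7.05 * t^3 + 5.5225 * t^4 < 1"
      using True by (simp add: eval_nat_numeral)
    then have "k\<^sup>2 < 2 * (1 - 1.376 * t - 1.6336 * t\<^sup>2 - 2.35 * t * t - 2.35 * t^3)"
      by (simp add: k_def eval_nat_numeral algebra_simps)
    also have "\<dots> \<le> 2 * C"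
      using mult_left_mono[OF assms(3), of t] assms(2) by (simp add: C_def)
    finally have "t * k\<^sup>2 < t * (2 * C)" using assms(2) by simp
    moreover have "u\<^sup>2 * k\<^sup>2 \<le> t * k\<^sup>2" using assms(3) by (intro mult_right_mono) auto
    ultimately show ?thesis by simp
  next
    case False
    \<comment> \<open>The upper bound combines t \<le> u with the linear constraint: 2.718 t \<le>
      0.8945. Below, 0.4135 bounds 0.8945 - 1.718 * 0.28, and 0.676 bounds k at t = 0.28.\<close>
    then have t: "0.28 \<le> t" "t \<le> 0.33" using assms(4,5) by auto
    have "t^2 \<le> 0.33^2" "t^3 \<le> 0.33^3" "0.28^2 \<le> t^2"
      using t by (intro power_mono; simp)+
    note t_pow = this
    have u2: "u\<^sup>2 \<le> 0.4135\<^sup>2"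
      using assms(1,4) t by (intro power_mono) auto
    have "0 \<le> k" "k \<le> 0.676" using t t_pow by (auto simp: k_def power2_eq_square)
    then have k2: "k\<^sup>2 \<le> 0.676\<^sup>2" by (intro power_mono)
    have "t * u\<^sup>2 \<le> 0.33 * 0.4135\<^sup>2" using t u2 by (intro mult_mono) auto
    then have C: "0.15 \<le> C" using t t_pow by (simp add: C_def eval_nat_numeral)
    have "u\<^sup>2 * k\<^sup>2 \<le> 0.4135\<^sup>2 * 0.676\<^sup>2" using u2 k2 by (intro mult_mono) auto
    also have "\<dots> < 0.28 * 0.3" by (simp add: power2_eq_square)
    also have "\<dots> \<le> t * (2 * C)" using t C by (intro mult_mono) auto
    finally show ?thesis by simp
  qed
  have "0 < 2 * t * ?G" unfolding sq using disc by (simp add: add_nonneg_pos)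
  then show ?thesis using assms(2) by (simp add: zero_less_mult_iff)
qed

text \<open>Here u and t stand for c 1 and c 2, and 0.94 t for both tails together. On |w| = 1 both
  squared moduli are polynomials in x = Re w, which leads to
  \<open>quadratic_part_poly\<close>.\<close>

lemma quadratic_part_estimate:
  fixes u t :: real and w :: complex
  assumes "0 \<le> u" "0 < t" "u\<^sup>2 \<le> t" "u + 1.718 * t \<le> 0.8945" "t \<le> u" "norm w = 1"
  shows "norm (of_real u * w + of_real t * w\<^sup>2) + 0.94 * t
           < norm (1 + of_real u * w + of_real (t / 2) * w\<^sup>2)"
proof -
  define x y where "x = Re w" and "y = Im w"
  let ?P = "norm (1 + of_real u * w + of_real (t / 2) * w\<^sup>2)"
  let ?Q = "norm (of_real u * w + of_real t * w\<^sup>2)"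
  have w: "w = Complex x y" by (simp add: x_def y_def)
  have xy: "x\<^sup>2 + y\<^sup>2 = 1" using assms(6) by (simp add: w cmod_def)
  then have y2: "y\<^sup>2 = 1 - x\<^sup>2" by simp
  have "?P\<^sup>2 = (1 + u * x + t/2 * (x\<^sup>2 - y\<^sup>2))\<^sup>2 + (u * y + t * x * y)\<^sup>2"
    unfolding cmod_power2 by (simp add: w power2_eq_square mult.assoc)
  also have "\<dots> = (1 + u * x + t/2 * (2*x\<^sup>2 - 1))\<^sup>2 + (u + t * x)\<^sup>2 * y\<^sup>2"
  proof -
    have "x\<^sup>2 - y\<^sup>2 = 2*x\<^sup>2 - 1" using y2 by simp
    moreover have "u * y + t * x * y = (u + t * x) * y" by (simp add: algebra_simps)
    ultimately show ?thesis by (simp only: power_mult_distrib)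
  qed
  also have "\<dots> = 1 + u\<^sup>2 + t\<^sup>2/4 + 2*u*x + t*(2*x\<^sup>2 - 1) + u*t*x"
    unfolding y2 by (simp add: power2_eq_square field_simps)
  finally have P: "?P\<^sup>2 = 1 + u\<^sup>2 + t\<^sup>2/4 + 2*u*x + t*(2*x\<^sup>2 - 1) + u*t*x" .
  have "?Q = norm (w * (of_real u + of_real t * w))"
    by (simp add: power2_eq_square algebra_simps)
  then have "?Q = norm (of_real u + of_real t * w)"
    using assms(6) by (simp add: norm_mult)
  then have "?Q\<^sup>2 = (norm (of_real u + of_real t * w))\<^sup>2" by simp
  also have "\<dots> = (u + t * x)\<^sup>2 + t\<^sup>2 * y\<^sup>2"
    unfolding cmod_power2 by (simp add: w power_mult_distrib)
  finally have Q: "?Q\<^sup>2 = u\<^sup>2 + t\<^sup>2 + 2*u*t*x"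
    unfolding y2 by (simp add: power2_eq_square algebra_simps)
  text \<open>By AM--GM, \<open>2 |Q| \<le> |Q|\<^sup>2 / s + s\<close>; here \<open>s = 2/5\<close>.\<close>
  have "0 \<le> (?Q - 0.4)\<^sup>2" by simp
  then have "?Q \<le> 1.25 * ?Q\<^sup>2 + 0.2"
    by (simp add: power2_eq_square algebra_simps)
  then have "1.88 * t * ?Q \<le> 1.88 * t * (1.25 * ?Q\<^sup>2 + 0.2)"
    using assms(2) by (intro mult_left_mono) auto
  then have "(?Q + 0.94 * t)\<^sup>2 \<le> (1 + 2.35 * t) * ?Q\<^sup>2 + 0.376 * t + (0.94 * t)\<^sup>2"
    by (simp add: power2_eq_square algebra_simps)
  also have "\<dots> < ?P\<^sup>2"
    unfolding P Q using quadratic_part_poly[OF assms(1-5), of x] by linarith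
  finally show ?thesis by (rule power2_less_imp_less) simp
qed

lemma exp_1_ge_2718: "2.718 \<le> exp (1::real)"
  using e_approx_32 by (simp add: abs_if power_divide split: if_split_asm)

text \<open>The sums are z g' and g at w, with quadratic parts Q and P. The chain is |z g'| \<le>
  |Q| + c 2 (e - 2) < |P| - c 2 (e - 5/2) \<le> |g|.\<close>

lemma norm_log_derivative_circle:
  fixes c :: "nat \<Rightarrow> real" and w :: complex
  assumes c0: "c 0 = 1" and c2: "c 2 > 0" and nonneg: "\<And>k. 0 \<le> c k" and dec: "decseq c"
    and lc: "(c 1)\<^sup>2 \<le> c 2" and bd: "c 1 + (exp 1 - 1) * c 2 \<le> 2 / sqrt 5"
    and w: "norm w = 1"
  shows "norm (\<Sum>k. of_nat k * (of_real (c k / fact k) * w ^ k))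
           < norm (\<Sum>k. of_real (c k / fact k) * w ^ k)"
proof -
  define P where "P = 1 + of_real (c 1) * w + of_real (c 2 / 2) * w\<^sup>2"
  define Q where "Q = of_real (c 1) * w + of_real (c 2) * w\<^sup>2"
  let ?f = "\<lambda>k. of_real (c k / fact k) * w ^ k"
  have c_le: "c (k + 3) \<le> c 2" for k using dec by (auto simp: decseq_def)
  have "norm (?f (k + 3)) \<le> c 2 / fact (k + 3)" for k
    using c_le[of k] nonneg by (auto simp: norm_mult norm_power w norm_divide intro!: divide_right_mono)
  note norm_suminf_diff_le_exp[OF this]
  moreover have "(\<Sum>k<3. ?f k) = P"
    by (simp add: P_def c0 eval_nat_numeral)
  moreover have "(\<Sum>k<3. 1 / fact k) = (5/2 :: real)"
    by (simp add: eval_nat_numeral)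
  ultimately have tf: "norm (suminf ?f - P) \<le> c 2 * (exp 1 - 5/2)" by simp
  have "norm (of_nat (k + 3) * ?f (k + 3)) \<le> c 2 / fact (k + 2)" for k
  proof -
    have "norm (of_nat (k + 3) * ?f (k + 3)) = real (k + 3) * (c (k + 3) / fact (k + 3))"
      using nonneg by (simp add: norm_mult norm_power w norm_divide del: of_nat_add)
    also have "\<dots> = c (k + 3) / fact (k + 2)"
      using fact_Suc[of "k + 2", where 'a = real] by (simp add: eval_nat_numeral)
    also have "\<dots> \<le> c 2 / fact (k + 2)" using c_le by (intro divide_right_mono) auto
    finally show ?thesis .
  qed
  note norm_suminf_diff_le_exp[OF this]
  moreover have "(\<Sum>k<3. of_nat k * ?f k) = Q"
    by (simp add: Q_def eval_nat_numeral)
  moreover have "(\<Sum>k<2. 1 / fact k) = (2 :: real)"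
    by (simp add: eval_nat_numeral)
  ultimately have tg: "norm ((\<Sum>k. of_nat k * ?f k) - Q) \<le> c 2 * (exp 1 - 2)" by simp
  have "1.718 * c 2 \<le> (exp 1 - 1) * c 2"
    using exp_1_ge_2718 c2 by (intro mult_right_mono) auto
  moreover have "2 / sqrt 5 \<le> (0.8945 :: real)"
  proof -
    have "2 / 0.8945 \<le> sqrt (5::real)" by (rule real_le_rsqrt) (simp add: power2_eq_square)
    then show ?thesis by (simp add: field_simps)
  qed
  ultimately have "c 1 + 1.718 * c 2 \<le> 0.8945" using bd by linarith
  then have "norm Q + 0.94 * c 2 < norm P"
    unfolding P_def Q_def
    using c2 lc nonneg[of 1] dec w by (intro quadratic_part_estimate) (auto simp: decseq_def)
  moreover have "c 2 * (exp 1 - 5/2) + c 2 * (exp 1 - 2) \<le> 0.94 * c 2"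
  proof -
    have "c 2 * (2 * exp 1 - 9/2) \<le> c 2 * 0.94"
      using c2 e_less_272 by (intro mult_left_mono) auto
    then show ?thesis by (simp add: algebra_simps)
  qed
  ultimately show ?thesis
    using tf tg norm_triangle_ineq2[of P "suminf ?f"]
      norm_triangle_ineq2[of "\<Sum>k. of_nat k * ?f k" Q] norm_minus_commute[of P] by smt
qed

section \<open>Starlikeness of series with decreasing coefficients\<close>

lemma summable_exponential_series:
  fixes c :: "nat \<Rightarrow> real" and z :: complex
  assumes "\<And>k. norm (c k) \<le> 1"
  shows "summable (\<lambda>k. of_real (c k / fact k) * z ^ k)"
proof (rule summable_comparison_test'[OF summable_exp[of "norm z"], of 0])
  fix k
  show "norm (of_real (c k / fact k) * z ^ k) \<le> inverse (fact k) * norm z ^ k"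
    using assms[of k] by (simp add: norm_mult norm_divide norm_power divide_simps mult_left_le_one_le)
qed

text \<open>The strict inequality |z g'| < |g| makes g zero-free and gives |z g' / g| < 1, so z f' /
  f = 1 + z g' / g has positive real part.\<close>

lemma starlike_function_exponential_series:
  fixes c :: "nat \<Rightarrow> real"
  assumes c0: "c 0 = 1" and pos: "\<And>k. 0 < c k" and dec: "decseq c"
    and lc: "(c 1)\<^sup>2 \<le> c 2" and bd: "c 1 + (exp 1 - 1) * c 2 \<le> 2 / sqrt 5"
  shows "starlike_function (\<lambda>z. z * (\<Sum>k. of_real (c k / fact k) * z ^ k))"
proof -
  define d :: "nat \<Rightarrow> complex" where "d k = of_real (c k / fact k)" for k
  define g where "g z = (\<Sum>k. d k * z ^ k)" for z
  have summ: "summable (\<lambda>k. d k * z ^ k)" for z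
    unfolding d_def using decseqD[OF dec, of 0] c0 pos
    by (intro summable_exponential_series) (simp add: abs_of_pos)
  have dg: "(g has_field_derivative (\<Sum>k. diffs d k * z ^ k)) (at z)" for z
    unfolding g_def by (rule termdiffs_strong_converges_everywhere[OF summ])
  have zdg: "z * deriv g z = (\<Sum>k. of_nat k * (d k * z ^ k))" for z
  proof -
    have "(\<lambda>k. of_nat k * d k * z ^ (k - Suc 0)) sums deriv g z"
      unfolding DERIV_imp_deriv[OF dg] by (intro diffs_equiv termdiff_converges_all summ)
    then have "(\<lambda>k. z * (of_nat k * d k * z ^ (k - Suc 0))) sums (z * deriv g z)"
      by (rule sums_mult)
    \<comment> \<open>At k = 0 the exponent truncates to 0, but the factor \<open>of_nat k\<close>
      removes the term.\<close>
    moreover have "z * (of_nat k * d k * z ^ (k - Suc 0)) = of_nat k * (d k * z ^ k)" for k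
      by (cases k) (auto simp: algebra_simps)
    ultimately show ?thesis by (simp add: sums_iff)
  qed
  have g0: "g 0 = 1"
    using powser_zero[of d] by (simp add: g_def d_def c0)
  have less: "norm (z * deriv g z) < norm (g z)" if z: "norm z < 1" for z
  proof (cases "z = 0")
    case False
    define r where "r = norm z"
    define w where "w = z / of_real r"
    have r: "0 < r" "r \<le> 1" and w: "norm w = 1" and zrw: "z = of_real r * w"
      using z False by (auto simp: r_def w_def norm_divide)
    \<comment> \<open>The radius moves into the coefficients: c k becomes c k r^k. The condition on
      squares is homogeneous in r, and the other bounds only improve as r \<le> 1.\<close>
    have "norm (\<Sum>k. of_nat k * (of_real (c k * r ^ k / fact k) * w ^ k))
            < norm (\<Sum>k. of_real (c k * r ^ k / fact k) * w ^ k)"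
    proof (rule norm_log_derivative_circle)
      show "decseq (\<lambda>k. c k * r ^ k)"
        unfolding decseq_def using dec r pos
        by (auto intro!: mult_mono power_decreasing simp: decseq_def less_imp_le)
      show "(c 1 * r ^ 1)\<^sup>2 \<le> c 2 * r ^ 2"
        using lc by (simp add: power_mult_distrib mult_right_mono)
      have "c 1 * r ^ 1 \<le> c 1 * 1" "c 2 * r ^ 2 \<le> c 2 * 1"
        using r pos by (auto intro!: mult_left_mono intro: less_imp_le simp: power_le_one)
      then have "c 1 * r ^ 1 + (exp 1 - 1) * (c 2 * r ^ 2) \<le> c 1 + (exp 1 - 1) * c 2"
        by (intro add_mono mult_left_mono) auto
      then show "c 1 * r ^ 1 + (exp 1 - 1) * (c 2 * r ^ 2) \<le> 2 / sqrt 5"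
        using bd by linarith
    qed (use c0 pos r w in \<open>auto simp: less_imp_le\<close>)
    moreover have "of_real (c k * r ^ k / fact k) * w ^ k = d k * z ^ k" for k
      by (simp add: d_def zrw power_mult_distrib)
    ultimately show ?thesis unfolding zdg g_def by (simp only:)
  qed (simp add: g0)
  have "starlike_function (\<lambda>z. z * g z)"
  proof (rule starlike_function_mult)
    show "g holomorphic_on ball 0 1"
      using dg by (auto simp: holomorphic_on_def field_differentiable_def
          intro: has_field_derivative_at_within)
    show "g z \<noteq> 0" if "z \<in> ball 0 1" for z
      using less[of z] that by auto
    show "Re (1 + z * deriv g z / g z) > 0" if "z \<in> ball 0 1" for z
    proof -
      have "norm (z * deriv g z / g z) < 1"
        using less[of z] that by (auto simp: norm_divide divide_simps)
      then show ?thesis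
        using abs_Re_le_cmod[of "z * deriv g z / g z"] by simp
    qed
  qed (rule g0)
  then show ?thesis by (simp add: g_def d_def)
qed

section \<open>Coefficients of the normalized Fox-Wright function\<close>

theorem theorem9:
  fixes p :: nat and A :: real and a b :: "nat \<Rightarrow> real"
  assumes "p \<ge> 1" and "A > 0"
    and "0 < a 1" and "mono_on {1..p} a"
    and "0 < b 1" and "mono_on {1..p} b"
    and "\<forall>k\<in>{1..p}. (\<Sum>j=1..k. b j) - (\<Sum>j=1..k. a j) \<ge> 0"
    and "(\<Prod>i=1..p. Gamma (a i + A) / Gamma (b i + A)
             - Gamma (a i + 2 * A) / Gamma (b i + 2 * A) * (1 - exp 1))
           \<le> 2 / sqrt 5 * (\<Prod>i=1..p. Gamma (a i) / Gamma (b i))"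
  shows "starlike_function
           (normalized_fox_wright p p (\<lambda>i. complex_of_real (a i)) (\<lambda>_. A)
                                      (\<lambda>i. complex_of_real (b i)) (\<lambda>_. A))"
proof -
  define R where "R = (\<lambda>x. \<Prod>i=1..p. Gamma (a i + x) / Gamma (b i + x))"
  define c where "c = (\<lambda>k. R (real k * A) / R 0)"
  have a: "a i > 0" and b: "b i > 0" if "i \<in> {1..p}" for i
    using mono_onD[OF assms(4), of 1 i] mono_onD[OF assms(6), of 1 i] assms(1,3,5) that by auto
  have R_pos: "R x > 0" if "x \<ge> 0" for x
    unfolding R_def using a b that by (intro prod_pos ballI divide_pos_pos Gamma_real_pos add_pos_nonneg) auto
  have maj: "(\<Sum>j=1..k. a j) \<le> (\<Sum>j=1..k. b j)" if "k \<in> {1..p}" for k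
    using assms(7) that by auto
  have R_dec: "R y \<le> R x" if "0 \<le> x" "x \<le> y" for x y
    unfolding R_def by (rule Gamma_ratio_majorization(1)[OF a b assms(6) maj that])
  have R_conv: "(R A)\<^sup>2 \<le> R 0 * R (2 * A)"
    unfolding R_def using assms(2)
    by (intro Gamma_ratio_majorization(2)[OF a b assms(6) maj]) auto
  have "R A + (exp 1 - 1) * R (2 * A)
          \<le> (\<Prod>i=1..p. Gamma (a i + A) / Gamma (b i + A)
               + (exp 1 - 1) * (Gamma (a i + 2 * A) / Gamma (b i + 2 * A)))"
    unfolding R_def
  proof (rule prod_add_mult_ge)
    show "1 \<le> exp 1 - (1::real)" using exp_1_ge_2718 by simp
    show "0 \<le> Gamma (a i + A) / Gamma (b i + A)"
      "0 \<le> Gamma (a i + 2 * A) / Gamma (b i + 2 * A)" if "i \<in> {1..p}" for i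
      using a[OF that] b[OF that] assms(2) by (simp_all add: add_pos_pos less_imp_le)
  qed (use assms(1) in auto)
  \<comment> \<open>The hypothesis subtracts a multiple of 1 - e, which amounts to adding the
    nonnegative multiple by e - 1.\<close>
  also have "\<dots> \<le> 2 / sqrt 5 * R 0"
  proof -
    have "x + (exp 1 - 1) * y = x - y * (1 - exp 1)" for x y :: real
      by (simp add: algebra_simps)
    then show ?thesis using assms(8) by (simp add: R_def)
  qed
  finally have bd: "R A + (exp 1 - 1) * R (2 * A) \<le> 2 / sqrt 5 * R 0" .
  have c0: "c 0 = 1" and c_pos: "0 < c k" for k
    using R_pos[of 0] R_pos[of "real k * A"] assms(2) by (simp_all add: c_def)
  have dec: "decseq c"
    unfolding decseq_def c_def using assms(2) R_pos[of 0]
    by (auto intro!: divide_right_mono R_dec mult_right_mono simp: less_imp_le)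
  have "starlike_function (\<lambda>z. z * (\<Sum>k. of_real (c k / fact k) * z ^ k))"
  proof (rule starlike_function_exponential_series[OF c0 c_pos dec])
    show "(c 1)\<^sup>2 \<le> c 2"
      using R_conv R_pos[of 0]
      by (simp add: c_def power_divide divide_simps power2_eq_square mult.commute)
    have "c 1 + (exp 1 - 1) * c 2 = (R A + (exp 1 - 1) * R (2 * A)) / R 0"
      by (simp add: c_def add_divide_distrib)
    also have "\<dots> \<le> 2 / sqrt 5"
      using bd R_pos[of 0] by (simp add: pos_divide_le_eq)
    finally show "c 1 + (exp 1 - 1) * c 2 \<le> 2 / sqrt 5" .
  qed
  also have "(\<lambda>z. z * (\<Sum>k. of_real (c k / fact k) * z ^ k)) =
      normalized_fox_wright p p (\<lambda>i. complex_of_real (a i)) (\<lambda>_. A)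
                                (\<lambda>i. complex_of_real (b i)) (\<lambda>_. A)"
  proof
    fix z :: complex
    \<comment> \<open>One factor of z^(k + 1) moves outside the sum, and R 0, split off by
      normalizing c 0 = 1, cancels against the Gamma prefactor.\<close>
    have term_eq: "(\<Prod>i=1..p. Gamma (of_real (a i) + of_nat k * of_real A)) /
        (\<Prod>i=1..p. Gamma (of_real (b i) + of_nat k * of_real A)) * (z ^ (k + 1) / fact k)
        = z * of_real (R 0) * (of_real (c k / fact k) * z ^ k)" for k
    proof -
      have "Gamma (complex_of_real x + of_nat k * of_real A) = of_real (Gamma (x + real k * A))" for x
        by (simp flip: Gamma_complex_of_real)
      then have "(\<Prod>i=1..p. Gamma (complex_of_real (a i) + of_nat k * of_real A)) /
          (\<Prod>i=1..p. Gamma (complex_of_real (b i) + of_nat k * of_real A)) = of_real (R (real k * A))"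
        by (simp add: R_def prod_dividef)
      also have "R (real k * A) = R 0 * c k"
        using R_pos[of 0] by (simp add: c_def)
      finally show ?thesis by simp
    qed
    have pref: "(\<Prod>i=1..p. Gamma (complex_of_real (b i))) / (\<Prod>i=1..p. Gamma (complex_of_real (a i)))
        = inverse (of_real (R 0))"
      by (simp add: R_def prod_dividef Gamma_complex_of_real)
    have summ: "summable (\<lambda>k. of_real (c k / fact k) * z ^ k)"
      using decseqD[OF dec, of 0] c0 c_pos
      by (intro summable_exponential_series) (simp add: abs_of_pos)
    show "z * (\<Sum>k. of_real (c k / fact k) * z ^ k) =
        normalized_fox_wright p p (\<lambda>i. complex_of_real (a i)) (\<lambda>_. A)
                                  (\<lambda>i. complex_of_real (b i)) (\<lambda>_. A) z"
      unfolding normalized_fox_wright_def term_eq pref suminf_mult[OF summ]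
      using R_pos[of 0] by simp
  qed
  finally show ?thesis .
qed

end
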